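(* Consider the SOS-convex semi-algebraic program $(P)$: minimize $f_0(x)$ over $x\in\mathbb{R}^n$ subject to $f_i(x)\le 0$, $i=1,\ldots,s$, where $f_0,\ldots,f_s$ are SOS-convex semi-algebraic functions with the representations fixed in the context, and let $(SDP)$ be the associated relaxation problem defined in the context. Suppose that there exists $x_0\in\mathbb{R}^n$ such that $f_i(x_0)<0$ for all $i=1,\ldots,s$. Then $$\mathrm{val}(P)=\mathrm{val}(SDP),$$ where $\mathrm{val}(P)$ and $\mathrm{val}(SDP)$ denote the optimal values of $(P)$ and $(SDP)$, respectively.
   Context: A real polynomial is sums-of-squares if it is a finite sum of squares of real polynomials. $\Sigma^2_d[x]$ is the set of sums-of-squares real polynomials in $x=(x_1,\ldots,x_n)$ of degree at most $d$. A real polynomial $f$ on $\mathbb{R}^n$ is SOS-convex if the polynomial $(x,y)\mapsto f(x)-f(y)-\nabla f(y)^T(x-y)$ is sums-of-squares on $\mathbb{R}^n\times\mathbb{R}^n$. For symmetric matrices, $M\succeq 0$ means $M$ is positive semidefinite. Setting of $(P)$: $d$ is an even number, and for each $i=0,1,\ldots,s$, $f_i:\mathbb{R}^n\to\mathbb{R}$ is an SOS-convex semi-algebraic function given by $$f_i(x)=\sup_{(y_1^i,\ldots,y_m^i)\in\Omega_i}\Big\{h_0^i(x)+\sum_{j=1}^m y_j^i h_j^i(x)\Big\},\quad m\in\mathbb{N},$$ where (1) each $h_j^i$ ($j=0,1,\ldots,m$) is a real polynomial on $\mathbb{R}^n$ of degree at most $d$, and for each $y^i=(y_1^i,\ldots,y_m^i)\in\Omega_i$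 the polynomial $h_0^i+\sum_{j=1}^m y_j^i h_j^i$ is SOS-convex; (2) $\Omega_i$ is a nonempty compact set of the form $$\Omega_i=\Big\{(y_1^i,\ldots,y_m^i)\in\mathbb{R}^m:\ \exists\, z^i=(z_1^i,\ldots,z_{p_i}^i)\in\mathbb{R}^{p_i}\text{ s.t. }A_0^i+\sum_{j=1}^m y_j^iA_j^i+\sum_{l=1}^{p_i}z_l^iB_l^i\succeq 0\Big\}$$ for some $p_i\in\mathbb{N}$ and some real symmetric matrices $A_j^i,B_l^i$ (all of the same size for fixed $i$). The problem $(SDP)$ is to find the supremum of $\mu$ over all $\mu\in\mathbb{R}$, $\lambda_0^i\ge 0$ ($i=1,\ldots,s$), $(\lambda_1^i,\ldots,\lambda_m^i)\in\mathbb{R}^m$ ($i=0,\ldots,s$), and $z_l^i\in\mathbb{R}$ ($i=0,\ldots,s$, $l=1,\ldots,p_i$) such that $$h_0^0+\sum_{j=1}^m\lambda_j^0h_j^0+\sum_{i=1}^s\Big(\lambda_0^ih_0^i+\sum_{j=1}^m\lambda_j^ih_j^i\Big)-\mu\in\Sigma^2_d[x],$$ $$A_0^0+\sum_{j=1}^m\lambda_j^0A_j^0+\sum_{l=1}^{p_0}z_l^0B_l^0\succeq 0,$$ $$\lambda_0^iA_0^i+\sum_{j=1}^m\lambda_j^iA_j^i+\sum_{l=1}^{p_i}z_l^iB_l^i\succeq 0,\quad i=1,\ldots,s.$$ Optimal values are extended-real numbers: $\mathrm{val}(P)$ is the infimum of $f_0$ over the feasible set of $(P)$, and $\mathrm{val}(SDP)$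 is the supremum above, with $\sup\emptyset=-\infty$. *)

theory Defs
  imports "HOL-Analysis.Analysis"
begin

text \<open>
  Polynomials on \<open>\<real>\<^sup>n\<close> are represented by the functions they induce, through the library predicate
  \<^const>\<open>real_polynomial_function\<close>; over the reals a polynomial and its function determine each other.
\<close>

lemma finite_exponents: "finite {\<alpha> :: 'n::finite \<Rightarrow> nat. sum \<alpha> UNIV \<le> d}"
proof (rule finite_subset)
  have "\<alpha> k \<le> d" if "sum \<alpha> UNIV \<le> d" for \<alpha> :: "'n \<Rightarrow> nat" and k
    using that member_le_sum[of k UNIV \<alpha>] by simp
  then show "{\<alpha> :: 'n \<Rightarrow> nat. sum \<alpha> UNIV \<le> d} \<subseteq> (UNIV \<rightarrow>\<^sub>E {..d})"
    by (simp add: subset_iff PiE_iff)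
  show "finite ((UNIV :: 'n set) \<rightarrow>\<^sub>E {..d})"
    by (intro finite_PiE) auto
qed

definition poly_degree_le :: "nat \<Rightarrow> (real ^ 'n::finite \<Rightarrow> real) \<Rightarrow> bool" where
  "poly_degree_le d f \<longleftrightarrow>
     (\<exists>c :: ('n \<Rightarrow> nat) \<Rightarrow> real. \<forall>x.
        f x = (\<Sum>\<alpha> | sum \<alpha> UNIV \<le> d. c \<alpha> * (\<Prod>k\<in>UNIV. (x $ k) ^ \<alpha> k)))"

definition sums_of_squares :: "('a::euclidean_space \<Rightarrow> real) \<Rightarrow> bool" where
  "sums_of_squares f \<longleftrightarrow>
     (\<exists>(r::nat) q. (\<forall>i<r. real_polynomial_function (q i)) \<and> (\<forall>x. f x = (\<Sum>i<r. (q i x)\<^sup>2)))"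

definition SOS_le :: "nat \<Rightarrow> (real ^ 'n::finite \<Rightarrow> real) set" where
  "SOS_le d = {f. sums_of_squares f \<and> poly_degree_le d f}"

definition sos_convex :: "(real ^ 'n::finite \<Rightarrow> real) \<Rightarrow> bool" where
  "sos_convex f \<longleftrightarrow> real_polynomial_function f \<and>
     (\<exists>g. (\<forall>y. GDERIV f y :> g y) \<and>
          sums_of_squares (\<lambda>(x, y). f x - f y - g y \<bullet> (x - y)))"

text \<open>
  A real \<open>k \<times> k\<close> matrix is a function \<^typ>\<open>nat \<Rightarrow> nat \<Rightarrow> real\<close> of which only the entries with both
  indices below \<open>k\<close> are relevant; the size has to be a number because it depends on \<open>i\<close>.
\<close>

definition symmetric_mat :: "nat \<Rightarrow> (nat \<Rightarrow> nat \<Rightarrow> real) \<Rightarrow> bool" where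
  "symmetric_mat k M \<longleftrightarrow> (\<forall>a<k. \<forall>b<k. M a b = M b a)"

definition psd :: "nat \<Rightarrow> (nat \<Rightarrow> nat \<Rightarrow> real) \<Rightarrow> bool" where
  "psd k M \<longleftrightarrow> symmetric_mat k M \<and>
     (\<forall>v :: nat \<Rightarrow> real. 0 \<le> (\<Sum>a<k. \<Sum>b<k. v a * M a b * v b))"

definition pencil ::
  "nat \<Rightarrow> nat \<Rightarrow> (nat \<Rightarrow> nat \<Rightarrow> nat \<Rightarrow> real) \<Rightarrow> (nat \<Rightarrow> nat \<Rightarrow> nat \<Rightarrow> real) \<Rightarrow>
    real \<Rightarrow> (nat \<Rightarrow> real) \<Rightarrow> (nat \<Rightarrow> real) \<Rightarrow> nat \<Rightarrow> nat \<Rightarrow> real" where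
  "pencil m p A B c y z =
     (\<lambda>a b. c * A 0 a b + (\<Sum>j=1..m. y j * A j a b) + (\<Sum>l=1..p. z l * B l a b))"

text \<open>
  \<open>\<real>\<^sup>m\<close> for a number \<open>m\<close> (possibly 0) is the space \<open>{1..m} \<rightarrow>\<^sub>E UNIV\<close> of real functions on \<open>{1..m}\<close>, with the product
  topology \<open>powertop_real {1..m}\<close>.
\<close>

definition Omega ::
  "nat \<Rightarrow> nat \<Rightarrow> nat \<Rightarrow> (nat \<Rightarrow> nat \<Rightarrow> nat \<Rightarrow> real) \<Rightarrow> (nat \<Rightarrow> nat \<Rightarrow> nat \<Rightarrow> real) \<Rightarrow>
    (nat \<Rightarrow> real) set" where
  "Omega m p k A B = {y \<in> {1..m} \<rightarrow>\<^sub>E UNIV. \<exists>z. psd k (pencil m p A B 1 y z)}"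

text \<open>
  Under the remaining conjuncts the supremum below is over a nonempty set that is bounded above,
  so the real \<open>SUP\<close> is the true supremum.
\<close>

definition sos_convex_semialgebraic ::
  "nat \<Rightarrow> nat \<Rightarrow> nat \<Rightarrow> nat \<Rightarrow> (nat \<Rightarrow> real ^ 'n::finite \<Rightarrow> real) \<Rightarrow>
    (nat \<Rightarrow> nat \<Rightarrow> nat \<Rightarrow> real) \<Rightarrow> (nat \<Rightarrow> nat \<Rightarrow> nat \<Rightarrow> real) \<Rightarrow> (real ^ 'n \<Rightarrow> real) \<Rightarrow> bool" where
  "sos_convex_semialgebraic d m p k h A B f \<longleftrightarrow>
     (\<forall>j\<in>{0..m}. poly_degree_le d (h j)) \<and>
     (\<forall>j\<in>{0..m}. symmetric_mat k (A j)) \<and>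
     (\<forall>l\<in>{1..p}. symmetric_mat k (B l)) \<and>
     Omega m p k A B \<noteq> {} \<and>
     compactin (powertop_real {1..m}) (Omega m p k A B) \<and>
     (\<forall>y\<in>Omega m p k A B. sos_convex (\<lambda>x. h 0 x + (\<Sum>j=1..m. y j * h j x))) \<and>
     (\<forall>x. f x = (SUP y\<in>Omega m p k A B. h 0 x + (\<Sum>j=1..m. y j * h j x)))"

definition val_P :: "nat \<Rightarrow> (nat \<Rightarrow> real ^ 'n::finite \<Rightarrow> real) \<Rightarrow> ereal" where
  "val_P s f = (INF x \<in> {x. \<forall>i\<in>{1..s}. f i x \<le> 0}. ereal (f 0 x))"

text \<open>\<open>lam 0 0\<close> does not occur: for \<open>i = 0\<close> the leading coefficient is 1.\<close>

definition SDP_feasible ::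
  "nat \<Rightarrow> nat \<Rightarrow> nat \<Rightarrow> (nat \<Rightarrow> nat) \<Rightarrow> (nat \<Rightarrow> nat) \<Rightarrow> (nat \<Rightarrow> nat \<Rightarrow> real ^ 'n::finite \<Rightarrow> real) \<Rightarrow>
    (nat \<Rightarrow> nat \<Rightarrow> nat \<Rightarrow> nat \<Rightarrow> real) \<Rightarrow> (nat \<Rightarrow> nat \<Rightarrow> nat \<Rightarrow> nat \<Rightarrow> real) \<Rightarrow>
    real \<Rightarrow> (nat \<Rightarrow> nat \<Rightarrow> real) \<Rightarrow> (nat \<Rightarrow> nat \<Rightarrow> real) \<Rightarrow> bool" where
  "SDP_feasible d s m p k h A B \<mu> lam z \<longleftrightarrow>
     (\<forall>i\<in>{1..s}. 0 \<le> lam i 0) \<and>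
     (\<lambda>x. h 0 0 x + (\<Sum>j=1..m. lam 0 j * h 0 j x)
          + (\<Sum>i=1..s. lam i 0 * h i 0 x + (\<Sum>j=1..m. lam i j * h i j x)) - \<mu>) \<in> SOS_le d \<and>
     psd (k 0) (pencil m (p 0) (A 0) (B 0) 1 (lam 0) (z 0)) \<and>
     (\<forall>i\<in>{1..s}. psd (k i) (pencil m (p i) (A i) (B i) (lam i 0) (lam i) (z i)))"

definition val_SDP ::
  "nat \<Rightarrow> nat \<Rightarrow> nat \<Rightarrow> (nat \<Rightarrow> nat) \<Rightarrow> (nat \<Rightarrow> nat) \<Rightarrow> (nat \<Rightarrow> nat \<Rightarrow> real ^ 'n::finite \<Rightarrow> real) \<Rightarrow>
    (nat \<Rightarrow> nat \<Rightarrow> nat \<Rightarrow> nat \<Rightarrow> real) \<Rightarrow> (nat \<Rightarrow> nat \<Rightarrow> nat \<Rightarrow> nat \<Rightarrow> real) \<Rightarrow> ereal" where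
  "val_SDP d s m p k h A B = Sup (ereal ` {\<mu>. \<exists>lam z. SDP_feasible d s m p k h A B \<mu> lam z})"

end

theory Submission imports Defs begin

text \<open>
  By the Slater condition and convexity, a lower bound \<open>v\<close> of \<open>f 0\<close> on the feasible set is a lower
  bound of the exact penalty function \<open>f 0 + L (\<Sum> i. max (f i) 0)\<close> for some finite \<open>L\<close>. This function is the
  maximum, over a compact set of dual variables, of Lagrangians that are linear in the dual
  variables and convex in \<open>x\<close>, so by minimax a single Lagrangian is bounded below by \<open>v\<close>. It is an
  SOS-convex polynomial; as a convex polynomial bounded below it attains its minimum at some \<open>y\<close>,
  and SOS-convexity at \<open>y\<close>, where the gradient vanishes, exhibits it minus its minimum as a sum
  of squares.
\<close>

section \<open>Convex polynomials\<close>

text \<open>Minimax needs a compact dual set, whereas the multipliers of (SDP) fill an unbounded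
  cone. The role of the finite weight \<open>L\<close> is to confine them to the interval from 0 to
  \<open>L\<close>; the Lagrangian is then found inside the truncated set, so the bound
  \<open>v\<close> itself is feasible in (SDP) and no closure argument is required. A second
  obstacle is that a multiplier \<open>l\<close> times a member of the family with parameter
  \<open>y\<close> is bilinear in \<open>(l, y)\<close>. Passing to \<open>(l, l y)\<close> makes it
  linear, and these are precisely the variables in which (SDP) is written. The opposite inequality
  must handle every feasible point of (SDP), including points with leading coefficient 0, which come
  from no parameter in \<open>\<Omega>\<close>; compactness of \<open>\<Omega>\<close> excludes a
  nonzero contribution from them. Attainment of the minimum cannot be weakened to an approximate
  minimum: SOS-convexity yields a sum of squares only after subtraction of the tangent at the chosen
  point, and it is at a minimizer that the tangent is constant.\<close>

lemma real_polynomial_function_bounded_imp_const: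
  fixes f :: "real \<Rightarrow> real"
  assumes "real_polynomial_function f" and bd: "\<And>t. 0 \<le> t \<Longrightarrow> \<bar>f t\<bar> \<le> M"
  shows "f t = f 0"
proof -
  obtain a n where f: "f = (\<lambda>x. \<Sum>i\<le>n. a i * x ^ i)"
    using assms(1) real_polynomial_function_iff_sum by blast
  have "a k = 0" if "1 \<le> k" "k \<le> n" for k
  proof (rule ccontr)
    assume "a k \<noteq> 0"
    with that have "\<exists>k. k \<noteq> 0 \<and> k \<le> n \<and> a k \<noteq> 0"
      by (intro exI[of _ k]) auto
    from polyfun_extremal[OF this, of "M + 1"] obtain b
      where b: "\<And>x::real. b \<le> norm x \<Longrightarrow> M + 1 \<le> norm (f x)"
      unfolding eventually_at_infinity f by blast
    \<comment> \<open>The growth estimate holds far out in both directions, the bound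
      \<open>M\<close> only on the nonnegative half-line; \<open>max b 0\<close> lies in both
      ranges.\<close>
    have "M + 1 \<le> norm (f (max b 0))"
      by (rule b) auto
    with bd[of "max b 0"] show False
      by auto
  qed
  then have "f x = a 0" for x
    unfolding f by (simp add: sum.atMost_shift)
  then show ?thesis
    by simp
qed

text \<open>
  The points \<open>X n\<close> of least norm in the sublevel sets must stay bounded: otherwise their
  directions accumulate at some \<open>w\<close> along which the polynomial is bounded on half-lines, hence
  constant, and moving \<open>X n\<close> along \<open>w\<close> would decrease its norm.
\<close>

lemma convex_polynomial_attains_inf:
  fixes f :: "'a::euclidean_space \<Rightarrow> real"
  assumes poly: "real_polynomial_function f" and conv: "convex_on UNIV f"
    and bdd: "\<And>x. v \<le> f x"
  shows "\<exists>x. \<forall>y. f x \<le> f y"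
proof -
  have cont: "continuous_on UNIV f"
    using poly by (simp add: continuous_on_polymonial_function real_polynomial_function_eq)
  define \<mu> where "\<mu> = Inf (range f)"
  have bb: "bdd_below (range f)"
    using bdd by (rule bdd_belowI2)
  then have \<mu>: "\<mu> \<le> f x" for x
    by (simp add: \<mu>_def cINF_lower)
  have "\<exists>x. f x \<le> \<mu> + inverse (Suc n) \<and> (\<forall>y. f y \<le> \<mu> + inverse (Suc n) \<longrightarrow> norm x \<le> norm y)" for n
  proof -
    have "closed {x. f x \<le> \<mu> + inverse (Suc n)}"
      using cont by (intro closed_Collect_le) auto
    moreover have "\<exists>x. f x < \<mu> + inverse (Suc n)"
    proof (rule ccontr)
      assume "\<not> (\<exists>x. f x < \<mu> + inverse (Suc n))"
      then have "\<mu> + inverse (Suc n) \<le> \<mu>"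
        unfolding \<mu>_def by (intro cINF_greatest) (auto simp: not_less)
      then show False
        by simp
    qed
    then have "{x. f x \<le> \<mu> + inverse (Suc n)} \<noteq> {}"
      using less_imp_le by blast
    ultimately show ?thesis
      by (metis (mono_tags, lifting) dist_0_norm distance_attains_inf mem_Collect_eq)
  qed
  then obtain X where X: "\<And>n. f (X n) \<le> \<mu> + inverse (Suc n)"
    and Xmin: "\<And>n y. f y \<le> \<mu> + inverse (Suc n) \<Longrightarrow> norm (X n) \<le> norm y"
    by metis
  have X1: "f (X n) \<le> \<mu> + 1" for n
    using X[of n] inverse_le_1_iff[of "real (Suc n)"] by linarith
  have lim0: "(\<lambda>n. inverse (real (Suc n))) \<longlonglongrightarrow> 0"
    by (rule LIMSEQ_inverse_real_of_nat)
  show ?thesis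
  proof (cases "bounded (range X)")
    case True
    then obtain l r where r: "strict_mono r" and l: "(X \<circ> r) \<longlonglongrightarrow> l"
      using bounded_imp_convergent_subsequence by blast
    have "(\<lambda>n. f (X (r n))) \<longlonglongrightarrow> f l"
      using continuous_on_tendsto_compose[OF cont l] by (simp add: o_def)
    moreover have "(\<lambda>n. \<mu> + inverse (real (Suc (r n)))) \<longlonglongrightarrow> \<mu> + 0"
      using LIMSEQ_subseq_LIMSEQ[OF lim0 r] by (intro tendsto_intros) (simp add: o_def)
    ultimately have "f l \<le> \<mu> + 0"
      by (rule LIMSEQ_le) (use X in blast)
    then show ?thesis
      using \<mu> by (metis add.right_neutral order_trans)
  next
    case False
    \<comment> \<open>The sublevel sets shrink as the index grows, so the least norms increase.
      Unboundedness thereby becomes divergence to infinity, which every subsequence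
      inherits.\<close>
    have mono: "norm (X m) \<le> norm (X n)" if "m \<le> n" for m n
    proof (rule Xmin)
      have "inverse (real (Suc n)) \<le> inverse (real (Suc m))"
        using that by (intro le_imp_inverse_le) auto
      then show "f (X n) \<le> \<mu> + inverse (Suc m)"
        using X[of n] by linarith
    qed
    have top: "filterlim (\<lambda>n. norm (X n)) at_top sequentially"
      unfolding filterlim_at_top eventually_sequentially
    proof
      fix Z :: real
      obtain N where "Z < norm (X N)"
        using False unfolding bounded_iff by (auto simp: not_le)
      then show "\<exists>N. \<forall>n\<ge>N. Z \<le> norm (X n)"
        using mono by (meson less_imp_le order_trans)
    qed
    define u where "u n = X n /\<^sub>R norm (X n)" for n
    have "norm (u n) \<le> 1" for n
      by (cases "X n = 0") (simp_all add: u_def)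
    then have "bounded (range u)"
      unfolding bounded_iff by blast
    then obtain w r where r: "strict_mono r" and w: "(u \<circ> r) \<longlonglongrightarrow> w"
      using bounded_imp_convergent_subsequence by blast
    have w': "(\<lambda>n. u (r n)) \<longlonglongrightarrow> w"
      using w by (simp add: o_def)
    have topr: "filterlim (\<lambda>n. norm (X (r n))) at_top sequentially"
      using filterlim_compose[OF top filterlim_subseq[OF r]] .
    have pos: "\<forall>\<^sub>F n in sequentially. 0 < norm (X (r n))"
      using topr unfolding filterlim_at_top_dense by blast
    \<comment> \<open>The point \<open>x + t *\<^sub>R w\<close> is a limit of points on the
      segments from \<open>x\<close> to \<open>X (r n)\<close>, taken with weight
      \<open>t / norm (X (r n))\<close>. Convexity bounds \<open>f\<close> there by a mean of
      \<open>f x\<close> and \<open>\<mu> + 1\<close> in which the second weight tends to 0.\<close>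
    have decr: "f (x + t *\<^sub>R w) \<le> f x" if "0 \<le> t" for x t
    proof -
      define \<tau> where "\<tau> n = t / norm (X (r n))" for n
      have \<tau>0: "\<tau> \<longlonglongrightarrow> 0"
        unfolding \<tau>_def using topr
        by (intro real_tendsto_divide_at_top[OF tendsto_const])
      have "(\<lambda>n. (1 - \<tau> n) * f x + \<tau> n * (\<mu> + 1)) \<longlonglongrightarrow> (1 - 0) * f x + 0 * (\<mu> + 1)"
        by (intro tendsto_intros \<tau>0)
      moreover have "(\<lambda>n. f (x - \<tau> n *\<^sub>R x + t *\<^sub>R u (r n))) \<longlonglongrightarrow> f (x - 0 *\<^sub>R x + t *\<^sub>R w)"
        by (intro continuous_on_tendsto_compose[OF cont] tendsto_intros \<tau>0 w') auto
      moreover have "\<forall>\<^sub>F n in sequentially.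
          f (x - \<tau> n *\<^sub>R x + t *\<^sub>R u (r n)) \<le> (1 - \<tau> n) * f x + \<tau> n * (\<mu> + 1)"
        using order_tendstoD(2)[OF \<tau>0 zero_less_one]
      proof eventually_elim
        case (elim n)
        have \<tau>: "0 \<le> \<tau> n"
          using that by (simp add: \<tau>_def)
        have "x - \<tau> n *\<^sub>R x + t *\<^sub>R u (r n) = (1 - \<tau> n) *\<^sub>R x + \<tau> n *\<^sub>R X (r n)"
          by (simp add: \<tau>_def u_def algebra_simps divide_inverse)
        also have "f \<dots> \<le> (1 - \<tau> n) * f x + \<tau> n * f (X (r n))"
          using convex_onD[OF conv \<tau>] elim by simp
        also have "\<dots> \<le> (1 - \<tau> n) * f x + \<tau> n * (\<mu> + 1)"
          using X1 \<tau> by (intro add_left_mono mult_left_mono)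
        finally show ?case .
      qed
      ultimately have "f (x - 0 *\<^sub>R x + t *\<^sub>R w) \<le> (1 - 0) * f x + 0 * (\<mu> + 1)"
        by (rule tendsto_le[OF sequentially_bot])
      then show ?thesis
        by simp
    qed
    \<comment> \<open>On the half-line \<open>decr\<close> bounds the polynomial from above and
      \<open>\<mu>\<close> from below. Being constant there, it is constant for negative
      \<open>t\<close> too, which is the direction used for \<open>y\<close> below.\<close>
    have const: "f (x + t *\<^sub>R w) = f x" for x t
    proof -
      have "polynomial_function (\<lambda>t::real. x + t *\<^sub>R w)"
        by (intro polynomial_function_add polynomial_function_mult) auto
      then have "real_polynomial_function (\<lambda>t. f (x + t *\<^sub>R w))"
        using real_polynomial_function_compose[OF _ poly] by (simp add: o_def)
      moreover have "\<bar>f (x + t *\<^sub>R w)\<bar> \<le> \<bar>f x\<bar> + \<bar>\<mu>\<bar>" if "0 \<le> t" for t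
        using decr[OF that, of x] \<mu>[of "x + t *\<^sub>R w"] by linarith
      ultimately have "f (x + t *\<^sub>R w) = f (x + 0 *\<^sub>R w)"
        by (rule real_polynomial_function_bounded_imp_const)
      then show ?thesis
        by simp
    qed
    have "(\<lambda>n. norm (u (r n))) \<longlonglongrightarrow> norm w"
      by (intro tendsto_intros w')
    moreover have "(\<lambda>n. norm (u (r n))) \<longlonglongrightarrow> 1"
      using pos by (rule tendsto_eventually[OF eventually_mono]) (simp add: u_def)
    ultimately have nw: "w \<bullet> w = 1"
      using LIMSEQ_unique by (metis norm_eq_1)
    have "(\<lambda>n. u (r n) \<bullet> w) \<longlonglongrightarrow> w \<bullet> w"
      by (intro tendsto_intros w')
    then have "\<forall>\<^sub>F n in sequentially. 0 < u (r n) \<bullet> w"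
      using nw by (intro order_tendstoD) auto
    with pos have "\<forall>\<^sub>F n in sequentially. 0 < X (r n) \<bullet> w"
      by eventually_elim (simp add: u_def zero_less_mult_iff)
    then obtain n where n: "0 < X n \<bullet> w"
      by (auto simp: eventually_sequentially)
    \<comment> \<open>Removing the component of \<open>X n\<close> along the unit vector
      \<open>w\<close> keeps the value of \<open>f\<close> and strictly decreases the norm.\<close>
    define y where "y = X n + (- (X n \<bullet> w)) *\<^sub>R w"
    have "f y = f (X n)"
      unfolding y_def by (rule const)
    then have "norm (X n) \<le> norm y"
      using X[of n] by (intro Xmin) simp
    moreover have "y \<bullet> y = X n \<bullet> X n - (X n \<bullet> w)\<^sup>2"
      using nw unfolding y_def
      by (simp add: inner_diff_left inner_diff_right inner_commute power2_eq_square)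
    then have "y \<bullet> y < X n \<bullet> X n"
      using n by simp
    then have "norm y < norm (X n)"
      by (simp add: norm_eq_sqrt_inner)
    ultimately show ?thesis
      by simp
  qed
qed

section \<open>Closure properties of sums of squares\<close>

lemma sums_of_squaresE:
  fixes f :: "'a::euclidean_space \<Rightarrow> real"
  assumes "sums_of_squares f"
  obtains r :: nat and q where "\<And>i. i < r \<Longrightarrow> real_polynomial_function (q i)"
    and "\<And>x. f x = (\<Sum>i<r. (q i x)\<^sup>2)"
  using assms unfolding sums_of_squares_def by blast

lemma sums_of_squares_const: "0 \<le> c \<Longrightarrow> sums_of_squares (\<lambda>x. c)"
  unfolding sums_of_squares_def by (intro exI[of _ 1] exI[of _ "\<lambda>_ _. sqrt c"]) auto

lemma sums_of_squares_add:
  fixes f :: "'a::euclidean_space \<Rightarrow> real"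
  assumes "sums_of_squares f" "sums_of_squares g"
  shows "sums_of_squares (\<lambda>x. f x + g x)"
proof -
  obtain r and q :: "nat \<Rightarrow> 'a \<Rightarrow> real"
    where q: "\<And>i. i < r \<Longrightarrow> real_polynomial_function (q i)" "\<And>x. f x = (\<Sum>i<r. (q i x)\<^sup>2)"
    using sums_of_squaresE[OF assms(1)] by blast
  obtain r' and q' :: "nat \<Rightarrow> 'a \<Rightarrow> real"
    where q': "\<And>i. i < r' \<Longrightarrow> real_polynomial_function (q' i)" "\<And>x. g x = (\<Sum>i<r'. (q' i x)\<^sup>2)"
    using sums_of_squaresE[OF assms(2)] by blast
  define Q where "Q i = (if i < r then q i else q' (i - r))" for i
  have "real_polynomial_function (Q i)" if "i < r + r'" for i
    using that q(1) q'(1) by (simp add: Q_def)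
  moreover have "(\<Sum>i<r + j. (Q i x)\<^sup>2) = (\<Sum>i<r. (q i x)\<^sup>2) + (\<Sum>i<j. (q' i x)\<^sup>2)" for x j
    by (induction j) (simp_all add: Q_def)
  then have "f x + g x = (\<Sum>i<r + r'. (Q i x)\<^sup>2)" for x
    by (simp add: q(2) q'(2))
  ultimately show ?thesis
    unfolding sums_of_squares_def by blast
qed

lemma sums_of_squares_cmult:
  fixes f :: "'a::euclidean_space \<Rightarrow> real"
  assumes "sums_of_squares f" "0 \<le> c"
  shows "sums_of_squares (\<lambda>x. c * f x)"
proof -
  obtain r and q :: "nat \<Rightarrow> 'a \<Rightarrow> real"
    where q: "\<And>i. i < r \<Longrightarrow> real_polynomial_function (q i)" "\<And>x. f x = (\<Sum>i<r. (q i x)\<^sup>2)"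
    using sums_of_squaresE[OF assms(1)] by blast
  have "real_polynomial_function (\<lambda>x. sqrt c * q i x)" if "i < r" for i
    using q(1)[OF that] by auto
  moreover have "c * f x = (\<Sum>i<r. (sqrt c * q i x)\<^sup>2)" for x
    using assms(2) by (simp add: q(2) sum_distrib_left power_mult_distrib)
  ultimately show ?thesis
    unfolding sums_of_squares_def by (intro exI[of _ r] exI[of _ "\<lambda>i x. sqrt c * q i x"]) auto
qed

lemma sums_of_squares_compose:
  fixes f :: "'a::euclidean_space \<Rightarrow> real" and g :: "'b::euclidean_space \<Rightarrow> 'a"
  assumes "sums_of_squares f" "polynomial_function g"
  shows "sums_of_squares (\<lambda>x. f (g x))"
proof -
  obtain r and q :: "nat \<Rightarrow> 'a \<Rightarrow> real"
    where q: "\<And>i. i < r \<Longrightarrow> real_polynomial_function (q i)" "\<And>x. f x = (\<Sum>i<r. (q i x)\<^sup>2)"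
    using sums_of_squaresE[OF assms(1)] by blast
  have "real_polynomial_function (\<lambda>x. q i (g x))" if "i < r" for i
    using real_polynomial_function_compose[OF assms(2) q(1)[OF that]] by (simp add: o_def)
  then show ?thesis
    unfolding sums_of_squares_def
    by (intro exI[of _ r] exI[of _ "\<lambda>i x. q i (g x)"]) (auto simp: q(2))
qed

lemma sums_of_squares_nonneg: "sums_of_squares f \<Longrightarrow> 0 \<le> f x"
  unfolding sums_of_squares_def by (metis sum_nonneg zero_le_power2)

section \<open>SOS-convex polynomials\<close>

lemma sos_convex_zero: "sos_convex (\<lambda>x. 0)"
  unfolding sos_convex_def using sums_of_squares_const[of 0]
  by (auto simp: case_prod_unfold intro!: exI[of _ "\<lambda>_. 0"] GDERIV_const)

lemma sos_convex_add:
  assumes "sos_convex f" "sos_convex g"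
  shows "sos_convex (\<lambda>x. f x + g x)"
proof -
  obtain f' where f: "\<And>y. GDERIV f y :> f' y"
    "sums_of_squares (\<lambda>(x, y). f x - f y - f' y \<bullet> (x - y))"
    using assms(1) unfolding sos_convex_def by blast
  obtain g' where g: "\<And>y. GDERIV g y :> g' y"
    "sums_of_squares (\<lambda>(x, y). g x - g y - g' y \<bullet> (x - y))"
    using assms(2) unfolding sos_convex_def by blast
  have sos: "sums_of_squares (\<lambda>(x, y). f x + g x - (f y + g y) - (f' y + g' y) \<bullet> (x - y))"
    using sums_of_squares_add[OF f(2) g(2)]
    by (simp add: case_prod_unfold algebra_simps inner_add_left)
  have der: "\<And>y. GDERIV (\<lambda>x. f x + g x) y :> f' y + g' y"
    by (intro GDERIV_add f g)
  have poly: "real_polynomial_function (\<lambda>x. f x + g x)"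
    using assms unfolding sos_convex_def by auto
  show ?thesis
    unfolding sos_convex_def by (intro conjI exI[of _ "\<lambda>y. f' y + g' y"] allI poly der sos)
qed

lemma sos_convex_cmult:
  assumes "sos_convex f" "0 \<le> c"
  shows "sos_convex (\<lambda>x. c * f x)"
proof -
  obtain f' where f: "\<And>y. GDERIV f y :> f' y"
    "sums_of_squares (\<lambda>(x, y). f x - f y - f' y \<bullet> (x - y))"
    using assms(1) unfolding sos_convex_def by blast
  have sos: "sums_of_squares (\<lambda>(x, y). c * f x - c * f y - (c *\<^sub>R f' y) \<bullet> (x - y))"
    using sums_of_squares_cmult[OF f(2) assms(2)]
    by (simp add: case_prod_unfold algebra_simps)
  have der: "GDERIV (\<lambda>x. c * f x) y :> c *\<^sub>R f' y" for y
    using GDERIV_mult[OF GDERIV_const[of c y] f(1)[of y]] by simp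
  have poly: "real_polynomial_function (\<lambda>x. c * f x)"
    using assms unfolding sos_convex_def by auto
  show ?thesis
    unfolding sos_convex_def by (intro conjI exI[of _ "\<lambda>y. c *\<^sub>R f' y"] allI poly der sos)
qed

lemma sos_convex_sum:
  assumes "finite I" "\<And>i. i \<in> I \<Longrightarrow> sos_convex (f i)"
  shows "sos_convex (\<lambda>x. \<Sum>i\<in>I. f i x)"
  using assms
proof (induction I rule: finite_induct)
  case empty
  then show ?case
    by (simp add: sos_convex_zero)
next
  case (insert i I)
  then show ?case
    by (simp add: sos_convex_add)
qed

text \<open>Nonnegativity of the sum of squares is the tangent inequality. Taken at the mean
  \<open>z\<close> of \<open>x\<close> and \<open>y\<close> and averaged with the same weights, its
  linear parts cancel.\<close>

lemma sos_convex_imp_convex_on: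
  fixes f :: "real ^ 'n::finite \<Rightarrow> real"
  assumes "sos_convex f"
  shows "convex_on UNIV f"
proof (rule convex_onI)
  obtain g where "sums_of_squares (\<lambda>(x, y). f x - f y - g y \<bullet> (x - y))"
    using assms unfolding sos_convex_def by blast
  then have g: "f y + g y \<bullet> (x - y) \<le> f x" for x y
    using sums_of_squares_nonneg[of _ "(x, y)"] by force
  fix t :: real and x y :: "real ^ 'n"
  assume t: "0 < t" "t < 1"
  define z where "z = (1 - t) *\<^sub>R x + t *\<^sub>R y"
  have "(1 - t) * (f z + g z \<bullet> (x - z)) + t * (f z + g z \<bullet> (y - z)) \<le> (1 - t) * f x + t * f y"
    using t by (intro add_mono mult_left_mono g) auto
  moreover have "(1 - t) * (f z + g z \<bullet> (x - z)) + t * (f z + g z \<bullet> (y - z))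
      = f z + g z \<bullet> ((1 - t) *\<^sub>R (x - z) + t *\<^sub>R (y - z))"
    by (simp add: inner_add_right algebra_simps)
  moreover have "(1 - t) *\<^sub>R (x - z) + t *\<^sub>R (y - z) = 0"
    by (simp add: z_def algebra_simps)
  ultimately show "f ((1 - t) *\<^sub>R x + t *\<^sub>R y) \<le> (1 - t) * f x + t * f y"
    by (simp add: z_def)
qed simp

lemma sos_convex_imp_sums_of_squares:
  fixes f :: "real ^ 'n::finite \<Rightarrow> real"
  assumes "sos_convex f" "\<And>x. v \<le> f x"
  shows "sums_of_squares (\<lambda>x. f x - v)"
proof -
  obtain g where g: "\<And>y. GDERIV f y :> g y"
    "sums_of_squares (\<lambda>(x, y). f x - f y - g y \<bullet> (x - y))"
    using assms(1) unfolding sos_convex_def by blast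
  obtain y where y: "\<And>x. f y \<le> f x"
    using convex_polynomial_attains_inf[OF _ sos_convex_imp_convex_on[OF assms(1)] assms(2)]
      assms(1) unfolding sos_convex_def by blast
  have "(\<lambda>h. h \<bullet> g y) = (\<lambda>h. 0)"
    using g(1)[of y] y unfolding gderiv_def
    by (intro has_derivative_local_min[of f]) (auto intro: always_eventually)
  then have "g y = 0"
    by (metis inner_eq_zero_iff)
  \<comment> \<open>Fixing the second argument is a polynomial substitution, so the sum of squares
    in \<open>(x, y)\<close> restricts to one in \<open>x\<close> alone.\<close>
  have "polynomial_function (\<lambda>x :: real ^ 'n. (x, y))"
    unfolding polynomial_function_iff_Basis_inner
    by (auto simp: inner_prod_def real_polynomial_function_eq
        intro!: polynomial_function_add polynomial_function_inner)
  from sums_of_squares_compose[OF g(2) this] have "sums_of_squares (\<lambda>x. f x - f y)"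
    using \<open>g y = 0\<close> by simp
  \<comment> \<open>The bound \<open>v\<close> may lie below the minimum \<open>f y\<close>; the gap
    is a nonnegative constant and hence a square.\<close>
  from sums_of_squares_add[OF this sums_of_squares_const[of "f y - v"]] show ?thesis
    using assms(2)[of y] by simp
qed

section \<open>Degree bounds\<close>

lemma poly_degree_le_add:
  assumes "poly_degree_le d f" "poly_degree_le d g"
  shows "poly_degree_le d (\<lambda>x. f x + g x)"
proof -
  obtain b c where "\<And>x. f x = (\<Sum>\<alpha> | sum \<alpha> UNIV \<le> d. b \<alpha> * (\<Prod>k\<in>UNIV. (x $ k) ^ \<alpha> k))"
    "\<And>x. g x = (\<Sum>\<alpha> | sum \<alpha> UNIV \<le> d. c \<alpha> * (\<Prod>k\<in>UNIV. (x $ k) ^ \<alpha> k))"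
    using assms unfolding poly_degree_le_def by blast
  then show ?thesis
    unfolding poly_degree_le_def
    by (intro exI[of _ "\<lambda>\<alpha>. b \<alpha> + c \<alpha>"]) (simp add: sum.distrib distrib_right)
qed

lemma poly_degree_le_cmult:
  assumes "poly_degree_le d f"
  shows "poly_degree_le d (\<lambda>x. a * f x)"
proof -
  obtain c where "\<And>x. f x = (\<Sum>\<alpha> | sum \<alpha> UNIV \<le> d. c \<alpha> * (\<Prod>k\<in>UNIV. (x $ k) ^ \<alpha> k))"
    using assms unfolding poly_degree_le_def by blast
  then show ?thesis
    unfolding poly_degree_le_def
    by (intro exI[of _ "\<lambda>\<alpha>. a * c \<alpha>"]) (simp add: sum_distrib_left mult.assoc)
qed

lemma poly_degree_le_const: "poly_degree_le d (\<lambda>x::real ^ 'n::finite. a)"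
proof -
  have "(\<Sum>\<alpha> | sum \<alpha> UNIV \<le> d. (if \<alpha> = (\<lambda>_. 0) then a else 0) * (\<Prod>k\<in>UNIV. (x $ k) ^ \<alpha> k)) = a"
    for x :: "real ^ 'n"
    using finite_exponents[where 'n='n, of d]
    by (subst sum.remove[where x="\<lambda>_. 0"]) (auto intro!: sum.neutral)
  then show ?thesis
    unfolding poly_degree_le_def by (intro exI[of _ "\<lambda>\<alpha>. if \<alpha> = (\<lambda>_. 0) then a else 0"]) auto
qed

lemma poly_degree_le_sum:
  assumes "finite I" "\<And>i. i \<in> I \<Longrightarrow> poly_degree_le d (f i)"
  shows "poly_degree_le d (\<lambda>x. \<Sum>i\<in>I. f i x)"
  using assms
proof (induction I rule: finite_induct)
  case empty
  then show ?case
    by (simp add: poly_degree_le_const)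
next
  case (insert i I)
  then show ?case
    by (simp add: poly_degree_le_add)
qed

section \<open>Minimax\<close>

text \<open>The image of \<open>C\<close> under \<open>(G, H)\<close> need not be convex, but by
  \<open>mix\<close> its downward closure \<open>D\<close> is, and by \<open>none\<close> it misses
  the quadrant \<open>Q\<close>. Since \<open>D\<close> is not bounded, the separation is applied to
  the convex hull \<open>K\<close> of the image, which is compact and contained in
  \<open>D\<close>.\<close>

lemma separate_pair:
  fixes G H :: "'c::topological_space \<Rightarrow> real"
  assumes C: "compact C" "C \<noteq> {}" and cont: "continuous_on C G" "continuous_on C H"
    and mix: "\<And>c c' t. c \<in> C \<Longrightarrow> c' \<in> C \<Longrightarrow> 0 \<le> t \<Longrightarrow> t \<le> 1 \<Longrightarrow>
      \<exists>e\<in>C. (1 - t) * G c + t * G c' \<le> G e \<and> (1 - t) * H c + t * H c' \<le> H e"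
    and none: "\<And>c. c \<in> C \<Longrightarrow> 0 \<le> H c \<Longrightarrow> G c < 0"
  shows "\<exists>a b. 0 \<le> a \<and> 0 \<le> b \<and> (\<forall>c\<in>C. a * G c + b * H c < 0)"
proof -
  define K where "K = convex hull ((\<lambda>c. (G c, H c)) ` C)"
  define D where "D = {p. \<exists>c\<in>C. fst p \<le> G c \<and> snd p \<le> H c}"
  define Q :: "(real \<times> real) set" where "Q = {0..} \<times> {0..}"
  have "convex D"
  proof (rule convexI)
    fix x y :: "real \<times> real" and u t :: real
    assume "x \<in> D" "y \<in> D" and ut: "0 \<le> u" "0 \<le> t" "u + t = 1"
    then obtain c c' where c: "c \<in> C" "fst x \<le> G c" "snd x \<le> H c"
      and c': "c' \<in> C" "fst y \<le> G c'" "snd y \<le> H c'"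
      unfolding D_def by blast
    obtain e where e: "e \<in> C" "u * G c + t * G c' \<le> G e" "u * H c + t * H c' \<le> H e"
      using mix[OF c(1) c'(1), of t] ut by (metis add_diff_cancel_right' le_add_same_cancel2)
    have "u * fst x + t * fst y \<le> u * G c + t * G c'" "u * snd x + t * snd y \<le> u * H c + t * H c'"
      using c c' ut by (auto intro!: add_mono mult_left_mono)
    with e show "u *\<^sub>R x + t *\<^sub>R y \<in> D"
      unfolding D_def by force
  qed
  then have "K \<subseteq> D"
    unfolding K_def by (intro hull_minimal) (auto simp: D_def)
  moreover have "D \<inter> Q = {}"
    using none unfolding D_def Q_def by fastforce
  ultimately have "K \<inter> Q = {}"
    by blast
  moreover have "compact K"
    unfolding K_def by (intro compact_convex_hull compact_continuous_image continuous_intros C cont)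
  moreover have "K \<noteq> {}" "convex K"
    using C by (auto simp: K_def convex_convex_hull)
  moreover have "convex Q" "closed Q"
    unfolding Q_def by (auto intro!: convex_Times closed_Times)
  ultimately obtain p \<beta> where p: "\<And>x. x \<in> K \<Longrightarrow> p \<bullet> x < \<beta>" "\<And>x. x \<in> Q \<Longrightarrow> \<beta> < p \<bullet> x"
    using separating_hyperplane_compact_closed[of K Q] by blast
  have "\<beta> < 0"
    using p(2)[of "(0, 0)"] by (simp add: Q_def inner_prod_def)
  \<comment> \<open>A linear functional bounded below on the quadrant has nonnegative coefficients:
    for negative \<open>a\<close> the value at \<open>\<beta> / a\<close> would equal
    \<open>\<beta>\<close>.\<close>
  have ray: "0 \<le> a" if "\<And>t. 0 \<le> t \<Longrightarrow> \<beta> < a * t" for a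
  proof (rule ccontr)
    assume "\<not> 0 \<le> a"
    then show False
      using that[of "\<beta> / a"] \<open>\<beta> < 0\<close> by (simp add: divide_nonpos_nonpos)
  qed
  have "0 \<le> fst p" "0 \<le> snd p"
    using p(2)[of "(t, 0)" for t] p(2)[of "(0, t)" for t]
    by (auto intro!: ray simp: Q_def inner_prod_def)
  moreover have "fst p * G c + snd p * H c < 0" if "c \<in> C" for c
  proof -
    have "(G c, H c) \<in> K"
      using that by (auto simp: K_def intro: hull_inc)
    from p(1)[OF this] \<open>\<beta> < 0\<close> show ?thesis
      by (simp add: inner_prod_def)
  qed
  ultimately show ?thesis
    by blast
qed

text \<open>
  In the induction step the hypothesis is applied to the part of \<open>C\<close> where the new function is
  nonnegative, which leaves two functions to be combined.
\<close>

lemma finite_alternative: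
  fixes F :: "'i \<Rightarrow> 'c::topological_space \<Rightarrow> real"
  assumes "finite I" "compact C" "C \<noteq> {}" "\<And>i. i \<in> I \<Longrightarrow> continuous_on C (F i)"
    and "\<And>c c' t. c \<in> C \<Longrightarrow> c' \<in> C \<Longrightarrow> 0 \<le> t \<Longrightarrow> t \<le> 1 \<Longrightarrow>
      \<exists>e\<in>C. \<forall>i\<in>I. (1 - t) * F i c + t * F i c' \<le> F i e"
    and "\<not> (\<exists>c\<in>C. \<forall>i\<in>I. 0 \<le> F i c)"
  shows "\<exists>w. (\<forall>i\<in>I. 0 \<le> w i) \<and> (\<forall>c\<in>C. (\<Sum>i\<in>I. w i * F i c) < 0)"
  using assms
proof (induction I arbitrary: C rule: finite_induct)
  case empty
  then show ?case by blast
next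
  case (insert i I)
  define C' where "C' = {c \<in> C. 0 \<le> F i c}"
  have mix: "\<exists>e\<in>C. \<forall>j\<in>insert i I. (1 - t) * F j c + t * F j c' \<le> F j e"
    if "c \<in> C" "c' \<in> C" "0 \<le> t" "t \<le> 1" for c c' t
    using insert.prems(4)[OF that] .
  show ?case
  proof (cases "C' = {}")
    case True
    then have "\<forall>c\<in>C. F i c < 0"
      by (auto simp: C'_def not_le)
    moreover have "(\<Sum>j\<in>insert i I. (if j = i then 1 else 0) * F j c) = F i c" for c
      using insert.hyps by (simp add: sum.neutral)
    ultimately show ?thesis
      by (intro exI[of _ "\<lambda>j. if j = i then 1 else 0"]) auto
  next
    case False
    have "closedin (top_of_set C) C'"
      using continuous_closedin_preimage[of C "F i" "{0..}"] insert.prems(3)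
      by (simp add: C'_def vimage_def Int_def)
    then have "compact C'"
      using insert.prems(1) closedin_compact by blast
    moreover have "continuous_on C' (F j)" if "j \<in> I" for j
      using insert.prems(3)[of j] that by (auto simp: C'_def intro: continuous_on_subset)
    moreover have "\<exists>e\<in>C'. \<forall>j\<in>I. (1 - t) * F j c + t * F j c' \<le> F j e"
      if ct: "c \<in> C'" "c' \<in> C'" "0 \<le> t" "t \<le> 1" for c c' t
    proof -
      obtain e where e: "e \<in> C" "\<forall>j\<in>insert i I. (1 - t) * F j c + t * F j c' \<le> F j e"
        using mix[of c c' t] ct unfolding C'_def by blast
      \<comment> \<open>The mixed point \<open>e\<close> stays in \<open>C'\<close>, because its
        value under \<open>F i\<close> is at least a mean of two nonnegative values.\<close>
      moreover have "0 \<le> (1 - t) * F i c + t * F i c'"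
        using ct by (auto simp: C'_def)
      ultimately show ?thesis
        unfolding C'_def by force
    qed
    moreover have "\<not> (\<exists>c\<in>C'. \<forall>j\<in>I. 0 \<le> F j c)"
      using insert.prems(5) by (auto simp: C'_def)
    ultimately obtain w where w: "\<forall>j\<in>I. 0 \<le> w j" "\<forall>c\<in>C'. (\<Sum>j\<in>I. w j * F j c) < 0"
      using insert.IH[of C'] False by blast
    define G where "G c = (\<Sum>j\<in>I. w j * F j c)" for c
    have "\<exists>a b. 0 \<le> a \<and> 0 \<le> b \<and> (\<forall>c\<in>C. a * G c + b * F i c < 0)"
    proof (rule separate_pair)
      show "continuous_on C G"
        unfolding G_def using insert.prems(3) by (intro continuous_intros) auto
      show "\<exists>e\<in>C. (1 - t) * G c + t * G c' \<le> G e \<and> (1 - t) * F i c + t * F i c' \<le> F i e"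
        if ct: "c \<in> C" "c' \<in> C" "0 \<le> t" "t \<le> 1" for c c' t
      proof -
        obtain e where e: "e \<in> C" "\<forall>j\<in>insert i I. (1 - t) * F j c + t * F j c' \<le> F j e"
          using mix[OF ct] by blast
        have "(1 - t) * G c + t * G c' = (\<Sum>j\<in>I. w j * ((1 - t) * F j c + t * F j c'))"
          unfolding G_def sum_distrib_left sum.distrib[symmetric]
          by (intro sum.cong) (auto simp: algebra_simps)
        also have "\<dots> \<le> G e"
          unfolding G_def using e(2) w(1) by (intro sum_mono mult_left_mono) auto
        finally show ?thesis
          using e by blast
      qed
      show "G c < 0" if "c \<in> C" "0 \<le> F i c" for c
        using w(2) that by (simp add: G_def C'_def)
    qed (use insert.prems in auto)
    then obtain a b where ab: "0 \<le> a" "0 \<le> b" "\<forall>c\<in>C. a * G c + b * F i c < 0"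
      by blast
    define W where "W j = (if j = i then b else a * w j)" for j
    have "(\<Sum>j\<in>insert i I. W j * F j c) = a * G c + b * F i c" for c
    proof -
      have "(\<Sum>j\<in>I. W j * F j c) = (\<Sum>j\<in>I. a * (w j * F j c))"
        using insert.hyps by (intro sum.cong) (auto simp: W_def)
      then show ?thesis
        using insert.hyps by (simp add: G_def sum_distrib_left W_def)
    qed
    then show ?thesis
      using ab w(1) by (intro exI[of _ W]) (auto simp: W_def)
  qed
qed

text \<open>Finitely many points \<open>x\<close> serve as the index set of the alternative: if no
  \<open>c\<close> handles them all, its weights give a mean of these points at which convexity
  contradicts \<open>ex\<close>. Compactness of \<open>C\<close> then passes from finitely many
  points to all.\<close>

lemma minimax_lower_bound:
  fixes F :: "'x::real_vector \<Rightarrow> 'c::topological_space \<Rightarrow> real"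
  assumes C: "compact C" and cont: "\<And>x. continuous_on UNIV (F x)"
    and conv: "\<And>c. c \<in> C \<Longrightarrow> convex_on UNIV (\<lambda>x. F x c)"
    and mix: "\<And>c c' t. c \<in> C \<Longrightarrow> c' \<in> C \<Longrightarrow> 0 \<le> t \<Longrightarrow> t \<le> 1 \<Longrightarrow>
      \<exists>e\<in>C. \<forall>x. (1 - t) * F x c + t * F x c' \<le> F x e"
    and ex: "\<And>x. \<exists>c\<in>C. v \<le> F x c"
  shows "\<exists>c\<in>C. \<forall>x. v \<le> F x c"
proof -
  have "C \<noteq> {}"
    using ex by blast
  have fin: "\<exists>c\<in>C. \<forall>x\<in>I. v \<le> F x c" if I: "finite I" for I
  proof (rule ccontr)
    assume "\<not> (\<exists>c\<in>C. \<forall>x\<in>I. v \<le> F x c)"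
    then have "\<not> (\<exists>c\<in>C. \<forall>x\<in>I. 0 \<le> F x c - v)"
      by simp
    moreover have "\<exists>e\<in>C. \<forall>x\<in>I. (1 - t) * (F x c - v) + t * (F x c' - v) \<le> F x e - v"
      if ct: "c \<in> C" "c' \<in> C" "0 \<le> t" "t \<le> 1" for c c' t
    proof -
      obtain e where "e \<in> C" "\<forall>x. (1 - t) * F x c + t * F x c' \<le> F x e"
        using mix[OF ct] by blast
      then show ?thesis
        by (intro bexI[of _ e]) (auto simp: algebra_simps)
    qed
    moreover have "continuous_on C (\<lambda>c. F x c - v)" for x
      by (intro continuous_intros continuous_on_subset[OF cont]) auto
    ultimately obtain w where w: "\<forall>x\<in>I. 0 \<le> w x" "\<forall>c\<in>C. (\<Sum>x\<in>I. w x * (F x c - v)) < 0"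
      using finite_alternative[OF I C \<open>C \<noteq> {}\<close>, of "\<lambda>x c. F x c - v"] by auto
    define W where "W = sum w I"
    have "0 \<le> W"
      using w(1) by (simp add: W_def sum_nonneg)
    \<comment> \<open>Zero weights would make the sum 0 instead of negative at any point of the
      nonempty set \<open>C\<close>.\<close>
    moreover have "W \<noteq> 0"
    proof
      assume "W = 0"
      then have "\<forall>x\<in>I. w x = 0"
        using w(1) I by (simp add: W_def sum_nonneg_eq_0_iff)
      then show False
        using w(2) \<open>C \<noteq> {}\<close> by auto
    qed
    ultimately have "0 < W"
      by simp
    then have "I \<noteq> {}"
      by (auto simp: W_def)
    obtain c where c: "c \<in> C" "v \<le> F (\<Sum>x\<in>I. (w x / W) *\<^sub>R x) c"
      using ex by blast
    have "F (\<Sum>x\<in>I. (w x / W) *\<^sub>R x) c \<le> (\<Sum>x\<in>I. w x / W * F x c)"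
      using \<open>0 < W\<close> w(1)
      by (intro convex_on_sum[OF I \<open>I \<noteq> {}\<close> conv[OF c(1)]])
        (auto simp: W_def simp flip: sum_divide_distrib)
    with c(2) have "v \<le> (\<Sum>x\<in>I. w x / W * F x c)"
      by linarith
    also have "\<dots> = (\<Sum>x\<in>I. w x * F x c) / W"
      by (simp add: sum_divide_distrib)
    finally have "W * v \<le> (\<Sum>x\<in>I. w x * F x c)"
      using \<open>0 < W\<close> by (simp add: field_simps)
    moreover have "(\<Sum>x\<in>I. w x * (F x c - v)) = (\<Sum>x\<in>I. w x * F x c) - W * v"
      by (simp add: W_def sum_subtractf algebra_simps sum_distrib_left)
    ultimately show False
      using w(2) c(1) by force
  qed
  have "C \<inter> \<Inter> ((\<lambda>x. {c. v \<le> F x c}) ` UNIV) \<noteq> {}"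
  proof (rule compact_imp_fip[OF C])
    show "closed T" if "T \<in> (\<lambda>x. {c. v \<le> F x c}) ` UNIV" for T
      using that cont by (auto intro!: closed_Collect_le)
    show "C \<inter> \<Inter> \<F> \<noteq> {}" if fin_sub: "finite \<F>" "\<F> \<subseteq> (\<lambda>x. {c. v \<le> F x c}) ` UNIV" for \<F>
    proof -
      obtain I where I: "finite I" "\<F> = (\<lambda>x. {c. v \<le> F x c}) ` I"
        using finite_subset_image[OF fin_sub] by metis
      from fin[OF I(1)] show ?thesis
        unfolding I(2) by blast
    qed
  qed
  then show ?thesis
    by blast
qed

section \<open>Duality\<close>

lemma psd_cone:
  assumes "psd k M" "psd k N" "0 \<le> a" "0 \<le> b"
  shows "psd k (\<lambda>i j. a * M i j + b * N i j)"
proof -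
  have "(\<Sum>i<k. \<Sum>j<k. v i * (a * M i j + b * N i j) * v j) =
      a * (\<Sum>i<k. \<Sum>j<k. v i * M i j * v j) + b * (\<Sum>i<k. \<Sum>j<k. v i * N i j * v j)" for v
    by (simp add: sum_distrib_left sum.distrib algebra_simps)
  then show ?thesis
    using assms unfolding psd_def symmetric_mat_def by simp
qed

lemma psd_pencil_cone:
  assumes "psd k (pencil m p A B c y z)" "psd k (pencil m p A B c' y' z')" "0 \<le> a" "0 \<le> b"
  shows "psd k (pencil m p A B (a * c + b * c') (\<lambda>j. a * y j + b * y' j) (\<lambda>l. a * z l + b * z' l))"
proof -
  have "pencil m p A B (a * c + b * c') (\<lambda>j. a * y j + b * y' j) (\<lambda>l. a * z l + b * z' l) =
      (\<lambda>i j. a * pencil m p A B c y z i j + b * pencil m p A B c' y' z' i j)"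
    by (intro ext) (simp add: pencil_def sum_distrib_left sum.distrib algebra_simps)
  then show ?thesis
    using psd_cone[OF assms] by simp
qed

lemma psd_pencil_scale:
  assumes "psd k (pencil m p A B c y z)" "0 \<le> a"
  shows "psd k (pencil m p A B (a * c) (\<lambda>j. a * y j) (\<lambda>l. a * z l))"
  using psd_pencil_cone[OF assms(1,1,2), of 0] by simp

lemma pencil_cong:
  assumes "\<And>j. j \<in> {1..m} \<Longrightarrow> y j = y' j"
  shows "pencil m p A B c y z = pencil m p A B c y' z"
  using assms by (simp add: pencil_def)

text \<open>Members of \<open>Omega\<close> are extensional on \<open>{1..m}\<close>, so a
  coefficient vector enters only after restriction; the pencil reads no other coordinates.\<close>

lemma restrict_in_Omega:
  assumes "psd k (pencil m p A B 1 y z)"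
  shows "restrict y {1..m} \<in> Omega m p k A B"
proof -
  have "pencil m p A B 1 (restrict y {1..m}) z = pencil m p A B 1 y z"
    by (rule pencil_cong) simp
  with assms show ?thesis
    unfolding Omega_def by (auto intro!: exI[of _ z])
qed

lemma Omega_convex:
  assumes "y \<in> Omega m p k A B" "y' \<in> Omega m p k A B" "0 \<le> a" "0 \<le> b" "a + b = 1"
  shows "(\<lambda>j\<in>{1..m}. a * y j + b * y' j) \<in> Omega m p k A B"
proof -
  obtain z z' where "psd k (pencil m p A B 1 y z)" "psd k (pencil m p A B 1 y' z')"
    using assms unfolding Omega_def by blast
  from psd_pencil_cone[OF this assms(3,4)] show ?thesis
    using assms(5) by (intro restrict_in_Omega) simp
qed

section \<open>Compactness and homogenized dual variables\<close>

text \<open>The inclusion of the extensional functions into all functions is continuous: coordinates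
  outside \<open>I\<close> are constantly \<open>undefined\<close>. This makes compactness available
  for the type-class topology.\<close>

lemma compactin_powertop_real_imp_compact:
  fixes S :: "('i \<Rightarrow> real) set"
  assumes "compactin (powertop_real I) S"
  shows "compact S"
proof -
  have "continuous_map (powertop_real I) euclideanreal (\<lambda>y. y k)" for k
  proof (cases "k \<in> I")
    case True
    then show ?thesis
      by (rule continuous_map_product_projection)
  next
    case False
    have "continuous_map (powertop_real I) euclideanreal (\<lambda>y. undefined)"
      by simp
    then show ?thesis
      by (rule continuous_map_eq) (use False in \<open>auto simp: PiE_def extensional_def\<close>)
  qed
  then have "continuous_map (powertop_real I) euclidean (\<lambda>y. y)"
    unfolding euclidean_product_topology[symmetric] continuous_map_componentwise_UNIV by blast
  from image_compactin[OF assms this] show ?thesis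
    by simp
qed

lemma compact_Pi_UNIV:
  fixes K :: "'i \<Rightarrow> 'c::topological_space set"
  assumes "\<And>i. compact (K i)"
  shows "compact (Pi UNIV K)"
proof -
  have "compactin (product_topology (\<lambda>i. euclidean) UNIV) (PiE UNIV K)"
    using assms by (simp add: compactin_PiE)
  then show ?thesis
    by (simp add: euclidean_product_topology PiE_UNIV_domain)
qed

text \<open>
  Points \<open>(l, l y)\<close> with \<open>y \<in> \<Omega>\<close> replace products of a multiplier \<open>l\<close> and a parameter \<open>y\<close>, so that the
  Lagrangian becomes linear in the dual variables.
\<close>

definition hom_comb :: "nat \<Rightarrow> (nat \<Rightarrow> 'a \<Rightarrow> real) \<Rightarrow> (nat \<Rightarrow> real) \<Rightarrow> 'a \<Rightarrow> real" where
  "hom_comb m h c x = c 0 * h 0 x + (\<Sum>j=1..m. c j * h j x)"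

definition aff_comb :: "nat \<Rightarrow> (nat \<Rightarrow> 'a \<Rightarrow> real) \<Rightarrow> (nat \<Rightarrow> real) \<Rightarrow> 'a \<Rightarrow> real" where
  "aff_comb m h y x = h 0 x + (\<Sum>j=1..m. y j * h j x)"

definition homogenize :: "real \<Rightarrow> (nat \<Rightarrow> real) \<Rightarrow> nat \<Rightarrow> real" where
  "homogenize l y j = (if j = 0 then l else l * y j)"

definition cone_over :: "real set \<Rightarrow> (nat \<Rightarrow> real) set \<Rightarrow> (nat \<Rightarrow> real) set" where
  "cone_over T \<Omega> = (\<lambda>(l, y). homogenize l y) ` (T \<times> \<Omega>)"

lemma hom_comb_homogenize: "hom_comb m h (homogenize l y) x = l * aff_comb m h y x"
  by (simp add: hom_comb_def aff_comb_def homogenize_def sum_distrib_left distrib_left mult.assoc)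

lemma aff_comb_restrict: "aff_comb m h (restrict y {1..m}) x = aff_comb m h y x"
  by (simp add: aff_comb_def)

lemma aff_comb_mix:
  assumes "a + b = 1"
  shows "aff_comb m h (\<lambda>j. a * y j + b * y' j) x = a * aff_comb m h y x + b * aff_comb m h y' x"
proof -
  have "a * aff_comb m h y x + b * aff_comb m h y' x =
      (a + b) * h 0 x + (\<Sum>j=1..m. (a * y j + b * y' j) * h j x)"
    by (simp add: aff_comb_def sum_distrib_left sum.distrib algebra_simps)
  then show ?thesis
    using assms by (simp add: aff_comb_def)
qed

lemma continuous_on_coordinate:
  "continuous_on S (\<lambda>c :: 'i \<Rightarrow> 'b::topological_space. c i)"
  by (rule continuous_on_product_then_coordinatewise[OF continuous_on_id])

lemma continuous_on_hom_comb: "continuous_on S (\<lambda>c. hom_comb m h c x)"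
  unfolding hom_comb_def by (intro continuous_intros continuous_on_coordinate)

lemma continuous_on_aff_comb: "continuous_on S (\<lambda>y. aff_comb m h y x)"
  unfolding aff_comb_def by (intro continuous_intros continuous_on_coordinate)

lemma compact_cone_over:
  assumes "compact T" "compact \<Omega>"
  shows "compact (cone_over T \<Omega>)"
  unfolding cone_over_def
proof (intro compact_continuous_image continuous_on_coordinatewise_then_product)
  have "continuous_on (T \<times> \<Omega>) (\<lambda>p. snd p j)" for j
    by (intro continuous_on_product_then_coordinatewise[OF continuous_on_snd[OF continuous_on_id]])
  then show "continuous_on (T \<times> \<Omega>) (\<lambda>p. (case p of (l, y) \<Rightarrow> homogenize l y) j)" for j
    by (cases "j = 0") (auto simp: case_prod_unfold homogenize_def intro!: continuous_intros)
qed (use assms in \<open>simp add: compact_Times\<close>)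

text \<open>In the coordinates \<open>(l, l y)\<close> a mean of two points has multiplier
  \<open>r = (1 - t) * l + t * l'\<close> and, if \<open>r\<close> is positive, as parameter the
  mean of \<open>y\<close> and \<open>y'\<close> with weights \<open>(1 - t) * l / r\<close> and
  \<open>t * l' / r\<close>.\<close>

lemma cone_over_Omega_mix:
  assumes T: "convex T" "T \<subseteq> {0..}"
    and c: "c \<in> cone_over T (Omega m p k A B)" and c': "c' \<in> cone_over T (Omega m p k A B)"
    and t: "0 \<le> t" "t \<le> 1"
  shows "\<exists>e\<in>cone_over T (Omega m p k A B). \<forall>x.
      hom_comb m h e x = (1 - t) * hom_comb m h c x + t * hom_comb m h c' x"
proof -
  obtain l y where ly: "l \<in> T" "y \<in> Omega m p k A B" "c = homogenize l y"
    using c unfolding cone_over_def by auto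
  obtain l' y' where ly': "l' \<in> T" "y' \<in> Omega m p k A B" "c' = homogenize l' y'"
    using c' unfolding cone_over_def by auto
  define r where "r = (1 - t) * l + t * l'"
  have "r \<in> T"
    using convexD[OF T(1) ly(1) ly'(1), of "1 - t" t] t by (simp add: r_def)
  have nn: "0 \<le> (1 - t) * l" "0 \<le> t * l'"
    using ly(1) ly'(1) T(2) t by auto
  show ?thesis
  \<comment> \<open>For \<open>r = 0\<close> there is nothing to divide by; both weighted
    multipliers vanish and any parameter serves.\<close>
  proof (cases "r = 0")
    case True
    then have zero: "(1 - t) * l = 0" "t * l' = 0"
      using nn unfolding r_def by linarith+
    have "hom_comb m h (homogenize r y) x = (1 - t) * hom_comb m h c x + t * hom_comb m h c' x" for x
      unfolding ly(3) ly'(3) hom_comb_homogenize mult.assoc[symmetric] zero True by simp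
    moreover have "homogenize r y \<in> cone_over T (Omega m p k A B)"
      using \<open>r \<in> T\<close> ly(2) unfolding cone_over_def by auto
    ultimately show ?thesis
      by blast
  next
    case False
    define a where "a = (1 - t) * l / r"
    define b where "b = t * l' / r"
    have ab: "0 \<le> a" "0 \<le> b" "a + b = 1" "r * a = (1 - t) * l" "r * b = t * l'"
      using nn False by (auto simp: a_def b_def r_def simp flip: add_divide_distrib)
    define w where "w = (\<lambda>j\<in>{1..m}. a * y j + b * y' j)"
    have "w \<in> Omega m p k A B"
      unfolding w_def using Omega_convex[OF ly(2) ly'(2) ab(1-3)] .
    then have "homogenize r w \<in> cone_over T (Omega m p k A B)"
      using \<open>r \<in> T\<close> unfolding cone_over_def by auto
    moreover have "hom_comb m h (homogenize r w) x
        = (1 - t) * hom_comb m h c x + t * hom_comb m h c' x" for x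
    proof -
      have "hom_comb m h (homogenize r w) x = r * a * aff_comb m h y x + r * b * aff_comb m h y' x"
        unfolding w_def hom_comb_homogenize aff_comb_restrict aff_comb_mix[OF ab(3)]
        by (simp add: algebra_simps)
      then show ?thesis
        unfolding ab ly(3) ly'(3) hom_comb_homogenize by simp
    qed
    ultimately show ?thesis
      by blast
  qed
qed

text \<open>Multiplying the witness of \<open>y\<close> by \<open>l\<close> yields the matrix
  constraint of (SDP). The entry \<open>c 0\<close> carries the multiplier and is not among the
  coordinates \<open>{1..m}\<close> that the pencil sums over.\<close>

lemma cone_over_Omega_psd:
  assumes "c \<in> cone_over T (Omega m p k A B)" "T \<subseteq> {0..}"
  shows "\<exists>z. psd k (pencil m p A B (c 0) c z)"
proof -
  obtain l y where ly: "l \<in> T" "y \<in> Omega m p k A B" "c = homogenize l y"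
    using assms(1) unfolding cone_over_def by auto
  obtain z where "psd k (pencil m p A B 1 y z)"
    using ly(2) unfolding Omega_def by blast
  from psd_pencil_scale[OF this, of l] have "psd k (pencil m p A B l (\<lambda>j. l * y j) (\<lambda>i. l * z i))"
    using ly(1) assms(2) by auto
  also have "pencil m p A B l (\<lambda>j. l * y j) (\<lambda>i. l * z i) = pencil m p A B (c 0) c (\<lambda>i. l * z i)"
    unfolding ly(3) by (subst pencil_cong[where y'="homogenize l y"]) (auto simp: homogenize_def)
  finally show ?thesis
    by blast
qed

section \<open>SOS-convex semialgebraic functions and the penalty function\<close>

text \<open>Compactness turns the supremum into a maximum. Convexity of \<open>f\<close> follows
  from the convexity of the one member polynomial that attains the maximum at the intermediate
  point.\<close>

lemma sos_convex_semialgebraicD: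
  fixes f :: "real ^ 'n::finite \<Rightarrow> real"
  assumes "sos_convex_semialgebraic d m p k h A B f"
  defines "\<Omega> \<equiv> Omega m p k A B"
  shows "\<And>j. j \<le> m \<Longrightarrow> poly_degree_le d (h j)" "\<Omega> \<noteq> {}" "compact \<Omega>"
    and "\<And>y. y \<in> \<Omega> \<Longrightarrow> sos_convex (aff_comb m h y)"
    and "\<And>x. \<exists>y\<in>\<Omega>. f x = aff_comb m h y x"
    and "\<And>x y. y \<in> \<Omega> \<Longrightarrow> aff_comb m h y x \<le> f x"
    and "convex_on UNIV f"
proof -
  note D = assms(1)[unfolded sos_convex_semialgebraic_def, folded \<Omega>_def]
  show "poly_degree_le d (h j)" if "j \<le> m" for j
    using D that by auto
  show ne: "\<Omega> \<noteq> {}"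
    using D by auto
  show cpt: "compact \<Omega>"
    using D compactin_powertop_real_imp_compact by blast
  show sc: "sos_convex (aff_comb m h y)" if "y \<in> \<Omega>" for y
    using D that by (auto simp: aff_comb_def[abs_def])
  have f: "f x = (SUP y\<in>\<Omega>. aff_comb m h y x)" for x
    using D by (auto simp: aff_comb_def)
  have max: "\<exists>y\<in>\<Omega>. \<forall>y'\<in>\<Omega>. aff_comb m h y' x \<le> aff_comb m h y x" for x
    by (rule continuous_attains_sup[OF cpt ne continuous_on_aff_comb])
  show att: "\<exists>y\<in>\<Omega>. f x = aff_comb m h y x" for x
  proof -
    obtain y where y: "y \<in> \<Omega>" "\<forall>y'\<in>\<Omega>. aff_comb m h y' x \<le> aff_comb m h y x"
      using max by blast
    then have "f x = aff_comb m h y x"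
      unfolding f by (intro cSup_eq_maximum) auto
    with y show ?thesis by blast
  qed
  show le: "aff_comb m h y x \<le> f x" if "y \<in> \<Omega>" for x y
    unfolding f
  proof (rule cSUP_upper[OF that])
    show "bdd_above ((\<lambda>y. aff_comb m h y x) ` \<Omega>)"
      using max[of x] by (auto intro: bdd_aboveI2)
  qed
  show "convex_on UNIV f"
  proof (rule convex_onI)
    fix t :: real and x x' :: "real ^ 'n"
    assume t: "0 < t" "t < 1"
    obtain y where y: "y \<in> \<Omega>"
      "f ((1 - t) *\<^sub>R x + t *\<^sub>R x') = aff_comb m h y ((1 - t) *\<^sub>R x + t *\<^sub>R x')"
      using att by blast
    note y(2)
    also have "aff_comb m h y ((1 - t) *\<^sub>R x + t *\<^sub>R x') \<le> (1 - t) * aff_comb m h y x + t * aff_comb m h y x'"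
      using t by (intro convex_onD[OF sos_convex_imp_convex_on[OF sc[OF y(1)]]]) auto
    also have "\<dots> \<le> (1 - t) * f x + t * f x'"
      using t by (intro add_mono mult_left_mono le y) auto
    finally show "f ((1 - t) *\<^sub>R x + t *\<^sub>R x') \<le> (1 - t) * f x + t * f x'" .
  qed simp
qed

text \<open>Moving from \<open>x\<close> towards the Slater point \<open>x0\<close> by the weight \<open>M / (\<eta> + M)\<close> restores feasibility.\<close>

lemma exact_penalty:
  fixes f0 :: "'a::real_vector \<Rightarrow> real"
  assumes I: "finite I" and conv: "convex_on UNIV f0" "\<And>i. i \<in> I \<Longrightarrow> convex_on UNIV (g i)"
    and slater: "\<And>i. i \<in> I \<Longrightarrow> g i x0 < 0"
    and v: "\<And>x. (\<And>i. i \<in> I \<Longrightarrow> g i x \<le> 0) \<Longrightarrow> v \<le> f0 x"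
  shows "\<exists>L\<ge>0. \<forall>x. v \<le> f0 x + (\<Sum>i\<in>I. L * max (g i x) 0)"
proof -
  \<comment> \<open>The slack common to all constraints at \<open>x0\<close>; the inserted 1 keeps
    the minimum defined and positive when \<open>I\<close> is empty.\<close>
  define \<eta> where "\<eta> = Min (insert 1 ((\<lambda>i. - g i x0) ` I))"
  have "0 < \<eta>"
    using I slater by (simp add: \<eta>_def)
  have \<eta>: "g i x0 \<le> - \<eta>" if "i \<in> I" for i
  proof -
    have "\<eta> \<le> - g i x0"
      unfolding \<eta>_def using I that by (intro Min_le) auto
    then show ?thesis by simp
  qed
  have v0: "v \<le> f0 x0"
    using slater by (intro v) force
  \<comment> \<open>This slope is read off from the end of the argument: convexity between
    \<open>x\<close> and \<open>x0\<close>, multiplied by \<open>\<eta> + M\<close>, rearranges to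
    \<open>v \<le> f0 x + L * M\<close>.\<close>
  define L where "L = (f0 x0 - v) / \<eta>"
  have "0 \<le> L"
    using v0 \<open>0 < \<eta>\<close> by (simp add: L_def)
  moreover have "v \<le> f0 x + (\<Sum>i\<in>I. L * max (g i x) 0)" for x
  proof -
    define M where "M = (\<Sum>i\<in>I. max (g i x) 0)"
    have M: "g i x \<le> M" if "i \<in> I" for i
      using member_le_sum[OF that, of "\<lambda>i. max (g i x) 0"] I by (simp add: M_def)
    have "0 \<le> M"
      by (simp add: M_def sum_nonneg)
    \<comment> \<open>The weight with \<open>(1 - t) * M = t * \<eta>\<close>: the bound
      \<open>M\<close> on every violation is offset by the slack at \<open>x0\<close>.\<close>
    define t where "t = M / (\<eta> + M)"
    have t: "0 \<le> t" "t \<le> 1" and t': "1 - t = \<eta> / (\<eta> + M)"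
      using \<open>0 < \<eta>\<close> \<open>0 \<le> M\<close> by (auto simp: t_def field_simps)
    define x' where "x' = (1 - t) *\<^sub>R x + t *\<^sub>R x0"
    have "g i x' \<le> 0" if "i \<in> I" for i
    proof -
      have "g i x' \<le> (1 - t) * g i x + t * g i x0"
        unfolding x'_def by (rule convex_onD[OF conv(2)[OF that] t]) auto
      also have "\<dots> \<le> (1 - t) * M + t * (- \<eta>)"
        using t by (intro add_mono mult_left_mono M \<eta> that) auto
      also have "\<dots> = 0"
        unfolding t' by (simp add: t_def)
      finally show ?thesis .
    qed
    then have "v \<le> f0 x'"
      by (rule v)
    also have "\<dots> \<le> (1 - t) * f0 x + t * f0 x0"
      unfolding x'_def by (rule convex_onD[OF conv(1) t]) auto
    also have "\<dots> = (\<eta> * f0 x + M * f0 x0) / (\<eta> + M)"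
      unfolding t' by (simp add: t_def add_divide_distrib)
    finally have "v * (\<eta> + M) \<le> \<eta> * f0 x + M * f0 x0"
      using \<open>0 < \<eta>\<close> \<open>0 \<le> M\<close> by (simp add: pos_le_divide_eq)
    then have "\<eta> * v \<le> \<eta> * f0 x + M * (f0 x0 - v)"
      by (simp add: algebra_simps)
    also have "\<dots> = \<eta> * (f0 x + L * M)"
      using \<open>0 < \<eta>\<close> by (simp add: L_def field_simps)
    finally have "v \<le> f0 x + L * M"
      using \<open>0 < \<eta>\<close> by simp
    then show ?thesis
      by (simp add: M_def sum_distrib_left)
  qed
  ultimately show ?thesis
    by blast
qed

text \<open>
  If the leading coefficient vanishes, \<open>c\<close> is a recession direction of the compact set \<open>\<Omega>\<close> and
  hence zero.
\<close>

lemma hom_comb_le: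
  fixes f :: "real ^ 'n::finite \<Rightarrow> real"
  assumes S: "sos_convex_semialgebraic d m p k h A B f"
    and psd: "psd k (pencil m p A B (c 0) c z)" and c0: "0 \<le> c 0"
  shows "hom_comb m h c x \<le> c 0 * f x"
proof (cases "c 0 = 0")
  case False
  \<comment> \<open>A positive leading coefficient can be divided out, which leaves an actual
    parameter in \<open>Omega\<close>.\<close>
  define y where "y = restrict (\<lambda>j. c j / c 0) {1..m}"
  have "psd k (pencil m p A B 1 (\<lambda>j. c j / c 0) (\<lambda>l. z l / c 0))"
    using psd_pencil_scale[OF psd, of "1 / c 0"] False c0 by simp
  then have "y \<in> Omega m p k A B"
    unfolding y_def by (rule restrict_in_Omega)
  then have "aff_comb m h y x \<le> f x"
    by (rule sos_convex_semialgebraicD(6)[OF S])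
  moreover have "c 0 * aff_comb m h y x = hom_comb m h c x"
    using False by (simp add: y_def aff_comb_restrict)
      (simp add: aff_comb_def hom_comb_def sum_distrib_left distrib_left)
  ultimately show ?thesis
    using c0 by (metis mult_left_mono)
next
  case True
  obtain y where y: "y \<in> Omega m p k A B"
    using sos_convex_semialgebraicD(2)[OF S] by blast
  then obtain w where w: "psd k (pencil m p A B 1 y w)"
    unfolding Omega_def by blast
  have "c j = 0" if j: "j \<in> {1..m}" for j
  proof -
    have "compact ((\<lambda>y. y j) ` Omega m p k A B)"
      by (intro compact_continuous_image continuous_on_coordinate sos_convex_semialgebraicD(3)[OF S])
    then have "bounded ((\<lambda>y. y j) ` Omega m p k A B)"
      by (rule compact_imp_bounded)
    then obtain M where M: "\<And>y. y \<in> Omega m p k A B \<Longrightarrow> \<bar>y j\<bar> \<le> M"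
      unfolding bounded_iff real_norm_def by blast
    \<comment> \<open>With leading coefficient 0, adding \<open>t\<close> times the pencil of
      \<open>c\<close> leaves the coefficient 1 of \<open>A 0\<close> unchanged, so the whole
      half-line from \<open>y\<close> stays in \<open>Omega\<close>.\<close>
    have ray: "\<bar>y j + t * c j\<bar> \<le> M" if "0 \<le> t" for t
    proof -
      have "psd k (pencil m p A B 1 (\<lambda>j. y j + t * c j) (\<lambda>l. w l + t * z l))"
        using psd_pencil_cone[OF w psd zero_le_one that] True by simp
      from M[OF restrict_in_Omega[OF this]] j show ?thesis
        by simp
    qed
    show ?thesis
    proof (rule ccontr)
      assume "c j \<noteq> 0"
      \<comment> \<open>Large enough that \<open>t * c j\<close> exceeds \<open>y j\<close> in
        absolute value by more than \<open>M\<close>.\<close>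
      define t where "t = (\<bar>y j\<bar> + \<bar>M\<bar> + 1) / \<bar>c j\<bar>"
      have "\<bar>t * c j\<bar> = \<bar>y j\<bar> + \<bar>M\<bar> + 1"
        using \<open>c j \<noteq> 0\<close> by (simp add: t_def abs_mult)
      moreover have "\<bar>y j + t * c j\<bar> \<le> M"
        by (rule ray) (simp add: t_def)
      ultimately show False
        by linarith
    qed
  qed
  then have "hom_comb m h c x = 0"
    using True by (simp add: hom_comb_def)
  then show ?thesis
    using True by simp
qed

section \<open>Weak and strong duality\<close>

text \<open>With the free entry \<open>lam 0 0\<close> set to 1, the objective is treated as one
  more index of the same sum and of the same matrix constraints.\<close>

lemma SDP_feasible_iff:
  assumes "lam 0 0 = 1"
  shows "SDP_feasible d s m p k h A B \<mu> lam z \<longleftrightarrow>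
    (\<forall>i\<in>{1..s}. 0 \<le> lam i 0) \<and>
    (\<lambda>x. (\<Sum>i=0..s. hom_comb m (h i) (lam i) x) - \<mu>) \<in> SOS_le d \<and>
    (\<forall>i\<in>{0..s}. psd (k i) (pencil m (p i) (A i) (B i) (lam i 0) (lam i) (z i)))"
proof -
  have "{0..s} = insert 0 {1..s}"
    by auto
  then show ?thesis
    using assms by (simp add: SDP_feasible_def hom_comb_def conj_ac add.assoc)
qed

text \<open>A sum of squares is nonnegative at \<open>x\<close>, so \<open>\<mu>\<close> is at most
  the Lagrangian there. Each of its terms is at most \<open>lam' i 0 * f i x\<close>, which is
  nonpositive for the constraints and \<open>f 0 x\<close> for the objective.\<close>

lemma weak_duality:
  assumes S: "\<And>i. i \<le> s \<Longrightarrow> sos_convex_semialgebraic d m (p i) (k i) (h i) (A i) (B i) (f i)"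
    and feas: "SDP_feasible d s m p k h A B \<mu> lam z"
    and x: "\<And>i. i \<in> {1..s} \<Longrightarrow> f i x \<le> 0"
  shows "\<mu> \<le> f 0 x"
proof -
  define lam' where "lam' i j = (if i = 0 \<and> j = 0 then 1 else lam i j)" for i j
  have "pencil m (p 0) (A 0) (B 0) c (lam' 0) (z 0) = pencil m (p 0) (A 0) (B 0) c (lam 0) (z 0)" for c
    by (rule pencil_cong) (simp add: lam'_def)
  moreover have "lam' i = lam i" if "i \<noteq> 0" for i
    using that by (simp add: lam'_def fun_eq_iff)
  ultimately have "SDP_feasible d s m p k h A B \<mu> lam' z"
    using feas by (simp add: SDP_feasible_def lam'_def[of 0])
  then have nn: "\<forall>i\<in>{1..s}. 0 \<le> lam' i 0"
    and sos: "(\<lambda>x. (\<Sum>i=0..s. hom_comb m (h i) (lam' i) x) - \<mu>) \<in> SOS_le d"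
    and psd: "\<forall>i\<in>{0..s}. psd (k i) (pencil m (p i) (A i) (B i) (lam' i 0) (lam' i) (z i))"
    by (simp_all add: SDP_feasible_iff lam'_def)
  have nn0: "0 \<le> lam' i 0" if "i \<in> {0..s}" for i
    using nn that by (cases "i = 0") (auto simp: lam'_def)
  have "\<mu> \<le> (\<Sum>i=0..s. hom_comb m (h i) (lam' i) x)"
    using sums_of_squares_nonneg[of _ x] sos unfolding SOS_le_def by fastforce
  also have "\<dots> \<le> (\<Sum>i=0..s. lam' i 0 * f i x)"
    using psd nn0 by (intro sum_mono hom_comb_le[OF S]) auto
  also have "\<dots> = f 0 x + (\<Sum>i=1..s. lam' i 0 * f i x)"
    by (simp add: sum.atLeast_Suc_atMost lam'_def[of 0])
  also have "(\<Sum>i=1..s. lam' i 0 * f i x) \<le> 0"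
    using nn x by (intro sum_nonpos mult_nonneg_nonpos) auto
  finally show ?thesis
    by simp
qed

lemma strong_duality:
  fixes f :: "nat \<Rightarrow> real ^ 'n::finite \<Rightarrow> real"
  assumes S: "\<And>i. i \<le> s \<Longrightarrow> sos_convex_semialgebraic d m (p i) (k i) (h i) (A i) (B i) (f i)"
    and slater: "\<And>i. i \<in> {1..s} \<Longrightarrow> f i x0 < 0"
    and v: "\<And>x. (\<And>i. i \<in> {1..s} \<Longrightarrow> f i x \<le> 0) \<Longrightarrow> v \<le> f 0 x"
  shows "\<exists>lam z. SDP_feasible d s m p k h A B v lam z"
proof -
  note D = sos_convex_semialgebraicD[OF S]
  obtain L where L: "0 \<le> L" "\<And>x. v \<le> f 0 x + (\<Sum>i=1..s. L * max (f i x) 0)"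
    using exact_penalty[of "{1..s}" "f 0" f x0 v] D(7) slater v by auto
  define \<Omega> where "\<Omega> i = Omega m (p i) (k i) (A i) (B i)" for i
  \<comment> \<open>The objective has the fixed multiplier 1. For a constraint,
    \<open>L * max (f i x) 0\<close> is the maximum of \<open>l * f i x\<close> over
    \<open>l\<close> in \<open>{0..L}\<close>.\<close>
  define T where "T i = (if i = 0 then {1} else {0..L})" for i :: nat
  \<comment> \<open>Dual variables are functions on all natural numbers; the singleton factors
    beyond \<open>s\<close> keep the product compact and do not enter \<open>F\<close>.\<close>
  define K where "K i = (if i \<le> s then cone_over (T i) (\<Omega> i) else {\<lambda>_. 0})" for i
  define C where "C = Pi UNIV K"
  define F where "F x lam = (\<Sum>i=0..s. hom_comb m (h i) (lam i) x)" for x lam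
  have T: "compact (T i)" "convex (T i)" "T i \<subseteq> {0..}" for i
    by (auto simp: T_def)
  have K0: "lam 0 0 = 1" if "lam \<in> C" for lam
    using that by (auto simp: C_def K_def T_def Pi_iff cone_over_def homogenize_def dest!: spec[of _ 0])
  have cone: "lam i \<in> cone_over (T i) (\<Omega> i)" if "lam \<in> C" "i \<le> s" for lam i
    using that by (auto simp: C_def K_def Pi_iff split: if_splits dest!: spec[of _ i])
  have sc: "sos_convex (\<lambda>x. F x lam)" if lam: "lam \<in> C" for lam
    unfolding F_def
  proof (rule sos_convex_sum)
    fix i assume "i \<in> {0..s}"
    then have i: "i \<le> s"
      by simp
    obtain l y where ly: "l \<in> T i" "y \<in> \<Omega> i" "lam i = homogenize l y"
      using cone[OF lam i] unfolding cone_over_def by auto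
    have "sos_convex (\<lambda>x. l * aff_comb m (h i) y x)"
      using ly(1,2) T(3)[of i] by (intro sos_convex_cmult D(4)[OF i]) (auto simp: \<Omega>_def)
    then show "sos_convex (\<lambda>x. hom_comb m (h i) (lam i) x)"
      by (simp add: ly(3) hom_comb_homogenize)
  qed simp
  have "\<exists>lam\<in>C. \<forall>x. v \<le> F x lam"
  proof (rule minimax_lower_bound)
    have "compact (K i)" for i
      unfolding K_def \<Omega>_def by (auto intro!: compact_cone_over T D(3))
    then show "compact C"
      unfolding C_def by (rule compact_Pi_UNIV)
    show "continuous_on UNIV (F x)" for x
      unfolding F_def
      by (intro continuous_on_sum continuous_on_compose2[OF continuous_on_hom_comb[of UNIV]]
          continuous_on_coordinate) auto
    show "convex_on UNIV (\<lambda>x. F x lam)" if "lam \<in> C" for lam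
      using sos_convex_imp_convex_on[OF sc[OF that]] .
    show "\<exists>e\<in>C. \<forall>x. (1 - t) * F x c + t * F x c' \<le> F x e"
      if c: "c \<in> C" "c' \<in> C" and t: "0 \<le> t" "t \<le> 1" for c c' t
    proof -
      have "\<exists>e. e \<in> K i \<and> (i \<le> s \<longrightarrow> (\<forall>x. hom_comb m (h i) e x
          = (1 - t) * hom_comb m (h i) (c i) x + t * hom_comb m (h i) (c' i) x))" for i
      proof (cases "i \<le> s")
        case True
        then show ?thesis
          using cone_over_Omega_mix[OF T(2,3) cone[OF c(1) True, unfolded \<Omega>_def]
              cone[OF c(2) True, unfolded \<Omega>_def] t, of "h i"]
          by (auto simp: K_def \<Omega>_def)
      qed (auto simp: K_def)
      then obtain e where e: "\<And>i. e i \<in> K i" "\<And>i x. i \<le> s \<Longrightarrow> hom_comb m (h i) (e i) x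
          = (1 - t) * hom_comb m (h i) (c i) x + t * hom_comb m (h i) (c' i) x"
        by metis
      have "F x e = (1 - t) * F x c + t * F x c'" for x
        by (simp add: F_def e(2) sum.distrib sum_distrib_left)
      then show ?thesis
        using e(1) by (intro bexI[of _ e]) (auto simp: C_def)
    qed
    show "\<exists>lam\<in>C. v \<le> F x lam" for x
    proof -
      \<comment> \<open>The multipliers that realize the penalty at this \<open>x\<close>: the full
        weight \<open>L\<close> on violated constraints, 0 on the others. Combined with parameters
        attaining each \<open>f i x\<close>, they make \<open>F x lam\<close> equal to the penalty
        function.\<close>
      define w where "w i = (if i = 0 then 1 else if 0 < f i x then L else 0)" for i :: nat
      have w: "w i \<in> T i" for i
        using L(1) by (simp add: w_def T_def)
      have "\<exists>c. c \<in> K i \<and> (i \<le> s \<longrightarrow> hom_comb m (h i) c x = w i * f i x)" for i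
      proof (cases "i \<le> s")
        case True
        obtain y where "y \<in> \<Omega> i" "f i x = aff_comb m (h i) y x"
          using D(5)[OF True] unfolding \<Omega>_def by blast
        then show ?thesis
          using True w by (intro exI[of _ "homogenize (w i) y"])
            (auto simp: K_def cone_over_def hom_comb_homogenize)
      qed (auto simp: K_def)
      then obtain lam where lam: "\<And>i. lam i \<in> K i"
        "\<And>i. i \<le> s \<Longrightarrow> hom_comb m (h i) (lam i) x = w i * f i x"
        by metis
      have "F x lam = (\<Sum>i=0..s. w i * f i x)"
        by (simp add: F_def lam(2))
      also have "\<dots> = f 0 x + (\<Sum>i=1..s. w i * f i x)"
        by (simp add: sum.atLeast_Suc_atMost w_def)
      also have "(\<Sum>i=1..s. w i * f i x) = (\<Sum>i=1..s. L * max (f i x) 0)"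
        by (intro sum.cong) (auto simp: w_def max_def)
      finally show ?thesis
        using L(2)[of x] lam(1) by (intro bexI[of _ lam]) (auto simp: C_def)
    qed
  qed
  then obtain lam where lam: "lam \<in> C" "\<And>x. v \<le> F x lam"
    by blast
  have "\<exists>z. i \<le> s \<longrightarrow> psd (k i) (pencil m (p i) (A i) (B i) (lam i 0) (lam i) z)" for i
    using cone_over_Omega_psd[OF cone[OF lam(1), unfolded \<Omega>_def] T(3)] by blast
  then obtain z where z: "\<And>i. i \<le> s \<Longrightarrow> psd (k i) (pencil m (p i) (A i) (B i) (lam i 0) (lam i) (z i))"
    by metis
  have "0 \<le> lam i 0" if "i \<le> s" for i
    using cone[OF lam(1) that] T(3)[of i] by (auto simp: cone_over_def homogenize_def)
  \<comment> \<open>The degree condition in \<open>SOS_le\<close> concerns the whole polynomial and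
    not the individual squares, so it follows from the degrees of the \<open>h i j\<close>.\<close>
  moreover have "poly_degree_le d (\<lambda>x. hom_comb m (h i) (lam i) x)" if "i \<le> s" for i
    unfolding hom_comb_def
    by (intro poly_degree_le_add poly_degree_le_sum poly_degree_le_cmult D(1)[OF that]) auto
  then have "poly_degree_le d (\<lambda>x. F x lam + (- v))"
    unfolding F_def by (intro poly_degree_le_add[OF _ poly_degree_le_const] poly_degree_le_sum) auto
  moreover have "sums_of_squares (\<lambda>x. F x lam - v)"
    using sos_convex_imp_sums_of_squares[OF sc[OF lam(1)] lam(2)] .
  ultimately have "SDP_feasible d s m p k h A B v lam z"
    using z by (auto simp: SDP_feasible_iff K0[OF lam(1)] SOS_le_def F_def)
  then show ?thesis
    by blast
qed

theorem theorem4p1: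
  fixes d s m :: nat and p k :: "nat \<Rightarrow> nat"
    and f :: "nat \<Rightarrow> real ^ 'n::finite \<Rightarrow> real"
    and h :: "nat \<Rightarrow> nat \<Rightarrow> real ^ 'n \<Rightarrow> real"
    and A B :: "nat \<Rightarrow> nat \<Rightarrow> nat \<Rightarrow> nat \<Rightarrow> real"
  assumes "even d"
    and "\<forall>i\<in>{0..s}. sos_convex_semialgebraic d m (p i) (k i) (h i) (A i) (B i) (f i)"
    and "\<exists>x0. \<forall>i\<in>{1..s}. f i x0 < 0"
  shows "val_P s f = val_SDP d s m p k h A B"
proof (rule antisym)
  have S: "sos_convex_semialgebraic d m (p i) (k i) (h i) (A i) (B i) (f i)" if "i \<le> s" for i
    using assms(2) that by simp
  show "val_SDP d s m p k h A B \<le> val_P s f"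
    unfolding val_SDP_def val_P_def
    by (intro Sup_least INF_greatest) (auto intro!: weak_duality[OF S])
  obtain x0 where x0: "\<And>i. i \<in> {1..s} \<Longrightarrow> f i x0 < 0"
    using assms(3) by blast
  have le: "val_P s f \<le> ereal (f 0 x)" if "\<And>i. i \<in> {1..s} \<Longrightarrow> f i x \<le> 0" for x
    unfolding val_P_def using that by (intro INF_lower) auto
  show "val_P s f \<le> val_SDP d s m p k h A B"
  \<comment> \<open>The Slater point is feasible, which rules out the value plus infinity; for minus
    infinity there is nothing to show. A finite value is itself a lower bound of \<open>f 0\<close>
    on the feasible set.\<close>
  proof (cases "val_P s f")
    case (real v)
    then have "\<exists>lam z. SDP_feasible d s m p k h A B v lam z"
      using le by (intro strong_duality[OF S x0]) auto
    then show ?thesis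
      unfolding real val_SDP_def by (intro Sup_upper) auto
  next
    case PInf
    then show ?thesis
      using le[of x0] x0 by (auto simp: less_imp_le)
  qed simp
qed

end
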